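(* Fix a leaf $k$ with parameters $(\bm\alpha_k,\bm\beta_k,\bm\gamma_k)$ satisfying $\gamma_{jk}\ge\underline\gamma>0$ for all $j\in\mathcal J$, and price bounds $0\le\underline p_j<\bar p_j<\infty$. For any scalar index $s\in\mathbb R$, the pricing problem $\max_{\bm p\in\mathcal P}R_k(\bm p,s)$ over $\mathcal P=\prod_{j\in\mathcal J}[\underline p_j,\bar p_j]$ has a unique optimizer, denoted $\bm p_k^*(s)$. It is characterized as follows. (i) Scalar fixed point. The equation $\Phi_k(\mu;s)=0$ has a unique solution $\mu_k^*(s)\in[0,\bar p_{\max}]$, where $\bar p_{\max}:=\max_{j\in\mathcal J}\bar p_j$. The optimizer is $\bm p_k^*(s)=(p_{jk}(\mu_k^*(s)))_{j\in\mathcal J}$. Thus a within-leaf pricing instance is solved by bisection on $[0,\bar p_{\max}]$; each evaluation of $\Phi_k$ costs $O(|\mathcal J|)$. (ii) Scalar sufficiency. If two feature vectors routed to leaf $k$ have the same value of $s_k(\bm x)=\bm\beta_k^\top\bm x$, then they have the same optimal price vector. Thus the within-leaf price map can be written as $\bm p_k^*(s)$. (iii) Regularity. The map $s\mapsto\bm p_k^*(s)$ is componentwise nondecreasing and Lipschitz: $$\|\bm p_k^*(s)-\bm p_k^*(s')\|_\infty\le\frac{\bar p_{\max}}{4}|s-s'|,\qquad s,s'\in\mathbb R.$$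
   Context: $\mathcal J$ is a finite nonempty set of products. In leaf $k$, a customer with feature vector $\bm x$ facing prices $\bm p$ has utility $\alpha_{jk}+\bm\beta_k^\top\bm x-\gamma_{jk}p_j$ for product $j\in\mathcal J$ and $0$ for no purchase, and chooses according to multinomial logit. The optimal price for $\bm x$ maximizes expected revenue $\sum_jp_j\pi_{jk}$ over $\mathcal P$. With scalar index $s=s_k(\bm x):=\bm\beta_k^\top\bm x$ and $A_{jk}(s):=\exp\{\alpha_{jk}+s\}$, define $$\pi_{jk}(\bm p,s)=\frac{A_{jk}(s)e^{-\gamma_{jk}p_j}}{1+\sum_{r\in\mathcal J}A_{rk}(s)e^{-\gamma_{rk}p_r}},\qquad R_k(\bm p,s)=\sum_{j\in\mathcal J}p_j\pi_{jk}(\bm p,s).$$ For a scalar $\mu$, with $\operatorname{clip}(x,a,b)=\min\{\max\{x,a\},b\}$, $$p_{jk}(\mu):=\operatorname{clip}(\gamma_{jk}^{-1}+\mu,\underline p_j,\bar p_j),\qquad \pi_{jk}(\mu,s):=\frac{A_{jk}(s)e^{-\gamma_{jk}p_{jk}(\mu)}}{1+\sum_{r\in\mathcal J}A_{rk}(s)e^{-\gamma_{rk}p_{rk}(\mu)}},$$ $$\Phi_k(\mu;s):=\sum_{j\in\mathcal J}p_{jk}(\mu)\pi_{jk}(\mu,s)-\mu.$$ *)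

theory Defs
  imports "HOL-Analysis.Analysis"
begin

text \<open>
  The finite nonempty product set is the index type \<open>'j::finite\<close>; per-product data and price
  vectors are elements of \<open>real ^ 'j\<close>, so the feasible set (the product of the price intervals)
  is \<open>cbox pl pu\<close> and the maximum norm is \<^const>\<open>infnorm\<close>.
  The arguments \<open>\<alpha>\<close>, \<open>\<beta>\<close>, \<open>\<gamma>\<close> below are the parameters of a single leaf.
\<close>

section \<open>Customer model\<close>

definition utility ::
  "real ^ 'j \<Rightarrow> real ^ 'd \<Rightarrow> real ^ 'j \<Rightarrow> real ^ 'd \<Rightarrow> real ^ 'j \<Rightarrow> 'j::finite \<Rightarrow> real" where
  "utility \<alpha> \<beta> \<gamma> x p j = \<alpha> $ j + \<beta> \<bullet> x - \<gamma> $ j * p $ j"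

text \<open>The summand \<open>exp 0\<close> is the no-purchase option, which has utility 0.\<close>

definition mnl :: "('j::finite \<Rightarrow> real) \<Rightarrow> 'j \<Rightarrow> real" where
  "mnl u j = exp (u j) / (exp 0 + (\<Sum>r\<in>UNIV. exp (u r)))"

definition customer_revenue ::
  "real ^ 'j \<Rightarrow> real ^ 'd \<Rightarrow> real ^ 'j \<Rightarrow> real ^ 'd \<Rightarrow> real ^ 'j::finite \<Rightarrow> real" where
  "customer_revenue \<alpha> \<beta> \<gamma> x p = (\<Sum>j\<in>UNIV. p $ j * mnl (utility \<alpha> \<beta> \<gamma> x p) j)"

definition is_customer_opt_price ::
  "real ^ 'j \<Rightarrow> real ^ 'd \<Rightarrow> real ^ 'j \<Rightarrow> real ^ 'j \<Rightarrow> real ^ 'j \<Rightarrow> real ^ 'd \<Rightarrow> real ^ 'j::finite \<Rightarrow> bool" where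
  "is_customer_opt_price \<alpha> \<beta> \<gamma> pl pu x p \<longleftrightarrow>
     is_arg_max (customer_revenue \<alpha> \<beta> \<gamma> x) (\<lambda>q. q \<in> cbox pl pu) p"

definition customer_opt_price ::
  "real ^ 'j \<Rightarrow> real ^ 'd \<Rightarrow> real ^ 'j \<Rightarrow> real ^ 'j \<Rightarrow> real ^ 'j \<Rightarrow> real ^ 'd \<Rightarrow> real ^ 'j::finite" where
  "customer_opt_price \<alpha> \<beta> \<gamma> pl pu x = (THE p. is_customer_opt_price \<alpha> \<beta> \<gamma> pl pu x p)"

section \<open>Pricing at a scalar index\<close>

definition attraction :: "real ^ 'j \<Rightarrow> real \<Rightarrow> 'j::finite \<Rightarrow> real" where
  "attraction \<alpha> s j = exp (\<alpha> $ j + s)"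

definition choice_prob :: "real ^ 'j \<Rightarrow> real ^ 'j \<Rightarrow> real ^ 'j \<Rightarrow> real \<Rightarrow> 'j::finite \<Rightarrow> real" where
  "choice_prob \<alpha> \<gamma> p s j =
     attraction \<alpha> s j * exp (- \<gamma> $ j * p $ j) /
     (1 + (\<Sum>r\<in>UNIV. attraction \<alpha> s r * exp (- \<gamma> $ r * p $ r)))"

definition revenue :: "real ^ 'j \<Rightarrow> real ^ 'j \<Rightarrow> real ^ 'j::finite \<Rightarrow> real \<Rightarrow> real" where
  "revenue \<alpha> \<gamma> p s = (\<Sum>j\<in>UNIV. p $ j * choice_prob \<alpha> \<gamma> p s j)"

definition is_opt_price ::
  "real ^ 'j \<Rightarrow> real ^ 'j \<Rightarrow> real ^ 'j \<Rightarrow> real ^ 'j \<Rightarrow> real \<Rightarrow> real ^ 'j::finite \<Rightarrow> bool" where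
  "is_opt_price \<alpha> \<gamma> pl pu s p \<longleftrightarrow>
     is_arg_max (\<lambda>q. revenue \<alpha> \<gamma> q s) (\<lambda>q. q \<in> cbox pl pu) p"

definition opt_price ::
  "real ^ 'j \<Rightarrow> real ^ 'j \<Rightarrow> real ^ 'j \<Rightarrow> real ^ 'j \<Rightarrow> real \<Rightarrow> real ^ 'j::finite" where
  "opt_price \<alpha> \<gamma> pl pu s = (THE p. is_opt_price \<alpha> \<gamma> pl pu s p)"

section \<open>Scalar fixed point\<close>

definition clip :: "real \<Rightarrow> real \<Rightarrow> real \<Rightarrow> real" where
  "clip x a b = min (max x a) b"

definition price_at ::
  "real ^ 'j \<Rightarrow> real ^ 'j \<Rightarrow> real ^ 'j \<Rightarrow> real \<Rightarrow> real ^ 'j::finite" where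
  "price_at \<gamma> pl pu \<mu> = (\<chi> j. clip (inverse (\<gamma> $ j) + \<mu>) (pl $ j) (pu $ j))"

definition Phi ::
  "real ^ 'j \<Rightarrow> real ^ 'j \<Rightarrow> real ^ 'j \<Rightarrow> real ^ 'j::finite \<Rightarrow> real \<Rightarrow> real \<Rightarrow> real" where
  "Phi \<alpha> \<gamma> pl pu s \<mu> =
     (\<Sum>j\<in>UNIV. price_at \<gamma> pl pu \<mu> $ j * choice_prob \<alpha> \<gamma> (price_at \<gamma> pl pu \<mu>) s j) - \<mu>"

definition pmax :: "real ^ 'j::finite \<Rightarrow> real" where
  "pmax pu = Max (range (\<lambda>j. pu $ j))"

definition mu_star ::
  "real ^ 'j \<Rightarrow> real ^ 'j \<Rightarrow> real ^ 'j \<Rightarrow> real ^ 'j::finite \<Rightarrow> real \<Rightarrow> real" where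
  "mu_star \<alpha> \<gamma> pl pu s = (THE \<mu>. \<mu> \<in> {0..pmax pu} \<and> Phi \<alpha> \<gamma> pl pu s \<mu> = 0)"

section \<open>Bisection\<close>

text \<open>The bracketing interval after a number of halvings, oriented for a function that is
  nonnegative to the left of its root and nonpositive to the right.\<close>

primrec bisect :: "(real \<Rightarrow> real) \<Rightarrow> real \<Rightarrow> real \<Rightarrow> nat \<Rightarrow> real \<times> real" where
  "bisect f a b 0 = (a, b)"
| "bisect f a b (Suc n) =
     (let (l, u) = bisect f a b n; m = (l + u) / 2
      in if f m \<ge> 0 then (m, u) else (l, m))"

section \<open>Cost of evaluating \<open>Phi\<close>\<close>

text \<open>Unit-cost model on the reals: an evaluation procedure is an arithmetic expression in the
  problem data, and each input access, constant and operation counts as one step.\<close>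

datatype 'j input = In_alpha 'j | In_gamma 'j | In_lower 'j | In_upper 'j | In_s | In_mu

datatype 'j aexp =
    Input "'j input"
  | Const real
  | Add "'j aexp" "'j aexp"
  | Sub "'j aexp" "'j aexp"
  | Mul "'j aexp" "'j aexp"
  | Div "'j aexp" "'j aexp"
  | Minimum "'j aexp" "'j aexp"
  | Maximum "'j aexp" "'j aexp"
  | Expo "'j aexp"

primrec aeval :: "('j input \<Rightarrow> real) \<Rightarrow> 'j aexp \<Rightarrow> real" where
  "aeval \<rho> (Input i) = \<rho> i"
| "aeval \<rho> (Const c) = c"
| "aeval \<rho> (Add a b) = aeval \<rho> a + aeval \<rho> b"
| "aeval \<rho> (Sub a b) = aeval \<rho> a - aeval \<rho> b"
| "aeval \<rho> (Mul a b) = aeval \<rho> a * aeval \<rho> b"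
| "aeval \<rho> (Div a b) = aeval \<rho> a / aeval \<rho> b"
| "aeval \<rho> (Minimum a b) = min (aeval \<rho> a) (aeval \<rho> b)"
| "aeval \<rho> (Maximum a b) = max (aeval \<rho> a) (aeval \<rho> b)"
| "aeval \<rho> (Expo a) = exp (aeval \<rho> a)"

primrec cost :: "'j aexp \<Rightarrow> nat" where
  "cost (Input i) = 1"
| "cost (Const c) = 1"
| "cost (Add a b) = 1 + cost a + cost b"
| "cost (Sub a b) = 1 + cost a + cost b"
| "cost (Mul a b) = 1 + cost a + cost b"
| "cost (Div a b) = 1 + cost a + cost b"
| "cost (Minimum a b) = 1 + cost a + cost b"
| "cost (Maximum a b) = 1 + cost a + cost b"
| "cost (Expo a) = 1 + cost a"

primrec problem_data ::
  "real ^ 'j \<Rightarrow> real ^ 'j \<Rightarrow> real ^ 'j \<Rightarrow> real ^ 'j::finite \<Rightarrow> real \<Rightarrow> real \<Rightarrow> 'j input \<Rightarrow> real" where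
  "problem_data \<alpha> \<gamma> pl pu s \<mu> (In_alpha j) = \<alpha> $ j"
| "problem_data \<alpha> \<gamma> pl pu s \<mu> (In_gamma j) = \<gamma> $ j"
| "problem_data \<alpha> \<gamma> pl pu s \<mu> (In_lower j) = pl $ j"
| "problem_data \<alpha> \<gamma> pl pu s \<mu> (In_upper j) = pu $ j"
| "problem_data \<alpha> \<gamma> pl pu s \<mu> In_s = s"
| "problem_data \<alpha> \<gamma> pl pu s \<mu> In_mu = \<mu>"

text \<open>One expression has to serve all problem data, so that no value depending on the data can be
  hidden in its constants. Only data with positive price sensitivities matter.\<close>

definition evaluates_Phi :: "'j::finite aexp \<Rightarrow> bool" where
  "evaluates_Phi e \<longleftrightarrow>
     (\<forall>\<alpha> \<gamma> pl pu s \<mu>. (\<forall>j. \<gamma> $ j > 0) \<longrightarrow>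
        aeval (problem_data \<alpha> \<gamma> pl pu s \<mu>) e = Phi \<alpha> \<gamma> pl pu s \<mu>)"

end

theory Submission imports Defs begin

text \<open>
  The optimum is found by turning the ratio of the multinomial logit revenue into a separable
  sum. Write \<open>w\<^sub>j(p) > 0\<close> for the unnormalised choice weight of product \<open>j\<close> at the prices \<open>p\<close>. Clearing
  the denominator, \<open>R(p, s) \<ge> \<mu>\<close> holds iff the excess \<open>(\<Sum>j. (p\<^sub>j - \<mu>) w\<^sub>j(p)) - \<mu>\<close> is
  nonnegative (\<open>revenue_minus_eq_excess\<close>). The weight \<open>w\<^sub>j\<close> depends on the price of \<open>j\<close> alone,
  so for a fixed target \<open>\<mu>\<close> the excess is maximised one product at a time, and each one-dimensional problem has the clipped
  price \<open>clip (1/\<gamma>\<^sub>j + \<mu>)\<close> as its only solution (\<open>clip_maximises_margin\<close>). Hence \<open>\<Phi>(\<mu>; s)\<close> has the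
  sign of the maximal excess at \<open>\<mu>\<close>, which is continuous and strictly decreasing in \<open>\<mu>\<close>. It has
  exactly one root \<open>\<mu>\<^sup>*\<close> in \<open>[0, p\<^sub>m\<^sub>a\<^sub>x]\<close>. At that root no feasible price vector has positive excess
  and only the clipped one has zero excess, so \<open>\<mu>\<^sup>*\<close> is the maximal revenue and the clipped prices are
  the only optimizer.

  Regularity follows because \<open>\<mu>\<^sup>*\<close> is an optimal value. For a fixed price vector the revenue is
  \<open>B e\<^sup>s / (1 + V e\<^sup>s)\<close> with \<open>0 \<le> B \<le> p\<^sub>m\<^sub>a\<^sub>x V\<close>, whose derivative in \<open>s\<close> lies in
  \<open>[0, p\<^sub>m\<^sub>a\<^sub>x/4]\<close> (\<open>revenue_index_increment\<close>). A maximum of functions with this property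
  inherits the bounds without any differentiation of \<open>\<mu>\<^sup>*\<close>, and clipping is monotone and does not expand
  distances.
\<close>

section \<open>Clipped prices\<close>

lemma clip_mono: "x \<le> y \<Longrightarrow> clip x a b \<le> clip y a b"
  by (auto simp: clip_def)

lemma clip_nonexpansive: "\<bar>clip x a b - clip y a b\<bar> \<le> \<bar>x - y\<bar>"
  by (auto simp: clip_def)

lemma clip_mem: "a \<le> b \<Longrightarrow> a \<le> clip x a b \<and> clip x a b \<le> b"
  by (auto simp: clip_def)

text \<open>
  The derivative of \<open>(x - \<mu>) exp (- \<gamma> x)\<close> has the sign of \<open>1 - \<gamma> (x - \<mu>)\<close>, so the function is unimodal
  with peak \<open>1/\<gamma> + \<mu>\<close> and the clipped peak is its maximiser on the interval. The proof
  avoids derivatives: it combines the first-order condition at the clipped peak with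
  \<open>exp t \<ge> 1 + t\<close>.
\<close>

lemma clip_maximises_margin:
  fixes g \<mu> a b x :: real
  assumes g: "g > 0" and x: "a \<le> x" "x \<le> b" and ne: "x \<noteq> clip (inverse g + \<mu>) a b"
  defines "c \<equiv> clip (inverse g + \<mu>) a b"
  shows "(x - \<mu>) * exp (- g * x) < (c - \<mu>) * exp (- g * c)"
proof -
  have first_order: "(g * (c - \<mu>) - 1) * (x - c) \<ge> 0"
  proof -
    consider "c = inverse g + \<mu>" | "c \<le> inverse g + \<mu>" "x \<le> c" | "c \<ge> inverse g + \<mu>" "c \<le> x"
    proof -
      have "c = inverse g + \<mu> \<or> c = b \<and> b \<le> inverse g + \<mu> \<or> c = a \<and> inverse g + \<mu> \<le> a"
        using x by (simp add: c_def clip_def min_def max_def)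
      then show thesis using x that by metis
    qed
    then show ?thesis
    proof cases
      case 1 then show ?thesis using g by simp
    next
      case 2
      then have "g * (c - \<mu>) \<le> g * inverse g" using g by (intro mult_left_mono) auto
      then show ?thesis using 2 g by (intro mult_nonpos_nonpos) auto
    next
      case 3
      then have "g * inverse g \<le> g * (c - \<mu>)" using g by (intro mult_left_mono) auto
      then show ?thesis using 3 g by (intro mult_nonneg_nonneg) auto
    qed
  qed
  have xc: "x \<noteq> c" using ne by (simp add: c_def)
  define t where "t = g * (x - c)"
  have "x - \<mu> < (c - \<mu>) * exp t"
    \<comment> \<open>The tangent bound can only be multiplied by a positive margin. For a nonpositive margin
      the clipped peak must be the upper bound, and \<open>exp t \<le> 1\<close> suffices.\<close>
  proof (cases "c - \<mu> > 0")
    case True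
    have "t \<noteq> 0" using g xc by (simp add: t_def)
    then have "1 + t < exp t" using exp_minus_greater[of "- t"] by simp
    then have "(c - \<mu>) * (1 + t) < (c - \<mu>) * exp t" using True by simp
    moreover have "x - \<mu> \<le> (c - \<mu>) * (1 + t)"
      using first_order by (simp add: t_def algebra_simps)
    ultimately show ?thesis by linarith
  next
    case False
    then have "g * (c - \<mu>) \<le> 0" using g by (simp add: mult_nonneg_nonpos)
    then have "x < c" using first_order xc by (simp add: zero_le_mult_iff)
    then have "exp t \<le> 1" using g by (simp add: t_def mult_le_0_iff)
    then have "c - \<mu> \<le> (c - \<mu>) * exp t"
      using False mult_left_mono_neg[of "exp t" 1 "c - \<mu>"] by simp
    moreover have "x - \<mu> < c - \<mu>" using \<open>x < c\<close> by simp
    ultimately show ?thesis by (rule less_le_trans[rotated])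
  qed
  then have "(x - \<mu>) * exp (- g * x) < (c - \<mu>) * exp t * exp (- g * x)" by simp
  also have "\<dots> = (c - \<mu>) * exp (- g * c)"
    by (simp add: t_def algebra_simps flip: exp_add)
  finally show ?thesis .
qed

lemma price_at_mono: "\<mu> \<le> \<nu> \<Longrightarrow> price_at \<gamma> pl pu \<mu> $ j \<le> price_at \<gamma> pl pu \<nu> $ j"
  by (simp add: price_at_def clip_mono)

lemma infnorm_cart_le:
  fixes x :: "real ^ 'n::finite"
  assumes "\<And>i. \<bar>x $ i\<bar> \<le> B"
  shows "infnorm x \<le> B"
  unfolding infnorm_cart using assms by (intro cSup_least) auto

lemma infnorm_price_at_diff_le:
  "infnorm (price_at \<gamma> pl pu \<mu> - price_at \<gamma> pl pu \<nu>) \<le> \<bar>\<mu> - \<nu>\<bar>"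
proof (rule infnorm_cart_le)
  fix j
  show "\<bar>(price_at \<gamma> pl pu \<mu> - price_at \<gamma> pl pu \<nu>) $ j\<bar> \<le> \<bar>\<mu> - \<nu>\<bar>"
    using clip_nonexpansive[of "inverse (\<gamma> $ j) + \<mu>" "pl $ j" "pu $ j" "inverse (\<gamma> $ j) + \<nu>"]
    by (simp add: price_at_def)
qed

lemma continuous_on_price_at: "continuous_on S (price_at \<gamma> pl pu)"
  unfolding price_at_def clip_def by (intro continuous_intros)

section \<open>Revenue at a target value\<close>

definition choice_weight :: "real ^ 'j \<Rightarrow> real ^ 'j \<Rightarrow> real ^ 'j \<Rightarrow> real \<Rightarrow> 'j::finite \<Rightarrow> real" where
  "choice_weight \<alpha> \<gamma> p s j = attraction \<alpha> s j * exp (- \<gamma> $ j * p $ j)"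

definition excess :: "real ^ 'j \<Rightarrow> real ^ 'j \<Rightarrow> real \<Rightarrow> real \<Rightarrow> real ^ 'j::finite \<Rightarrow> real" where
  "excess \<alpha> \<gamma> s \<mu> p = (\<Sum>j\<in>UNIV. (p $ j - \<mu>) * choice_weight \<alpha> \<gamma> p s j) - \<mu>"

lemma choice_weight_pos: "choice_weight \<alpha> \<gamma> p s j > 0"
  by (simp add: choice_weight_def attraction_def)

lemma choice_denominator_pos: "1 + (\<Sum>r\<in>UNIV. choice_weight \<alpha> \<gamma> p s r) > 0"
  by (intro add_pos_nonneg sum_nonneg) (auto intro: less_imp_le choice_weight_pos)

lemma revenue_eq:
  "revenue \<alpha> \<gamma> p s =
     (\<Sum>j\<in>UNIV. p $ j * choice_weight \<alpha> \<gamma> p s j) / (1 + (\<Sum>r\<in>UNIV. choice_weight \<alpha> \<gamma> p s r))"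
  by (simp add: revenue_def choice_prob_def choice_weight_def sum_divide_distrib)

text \<open>Both sides of \<open>R \<ge> \<mu>\<close> are multiplied by the denominator; what remains is a sum with one
  summand per product.\<close>

lemma revenue_minus_eq_excess:
  "revenue \<alpha> \<gamma> p s - \<mu> = excess \<alpha> \<gamma> s \<mu> p / (1 + (\<Sum>r\<in>UNIV. choice_weight \<alpha> \<gamma> p s r))"
  using choice_denominator_pos[of \<alpha> \<gamma> p s]
  by (simp add: revenue_eq excess_def field_simps sum_subtractf sum_distrib_left)

lemma Phi_eq: "Phi \<alpha> \<gamma> pl pu s \<mu> = revenue \<alpha> \<gamma> (price_at \<gamma> pl pu \<mu>) s - \<mu>"
  by (simp add: Phi_def revenue_def)

text \<open>The summands are maximised separately, so a loss in a single coordinate already makes the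
  inequality strict. The strict form is what makes the optimizer unique.\<close>

lemma excess_le:
  assumes \<gamma>: "\<And>j. \<gamma> $ j > 0" and q: "q \<in> cbox pl pu"
  shows "excess \<alpha> \<gamma> s \<mu> q \<le> excess \<alpha> \<gamma> s \<mu> (price_at \<gamma> pl pu \<mu>)"
    and "q \<noteq> price_at \<gamma> pl pu \<mu> \<Longrightarrow>
      excess \<alpha> \<gamma> s \<mu> q < excess \<alpha> \<gamma> s \<mu> (price_at \<gamma> pl pu \<mu>)"
proof -
  let ?p = "price_at \<gamma> pl pu \<mu>"
  let ?m = "\<lambda>p j. (p $ j - \<mu>) * choice_weight \<alpha> \<gamma> p s j"
  have strict: "?m q j < ?m ?p j" if "q $ j \<noteq> ?p $ j" for j
  proof -
    have "(q $ j - \<mu>) * exp (- \<gamma> $ j * q $ j) < (?p $ j - \<mu>) * exp (- \<gamma> $ j * ?p $ j)"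
      using clip_maximises_margin[of "\<gamma> $ j" "pl $ j" "q $ j" "pu $ j" \<mu>] \<gamma> q that
      by (simp add: price_at_def mem_box_cart)
    then have "attraction \<alpha> s j * ((q $ j - \<mu>) * exp (- \<gamma> $ j * q $ j))
        < attraction \<alpha> s j * ((?p $ j - \<mu>) * exp (- \<gamma> $ j * ?p $ j))"
      by (simp add: attraction_def)
    then show ?thesis by (simp add: choice_weight_def mult_ac)
  qed
  have le: "?m q j \<le> ?m ?p j" for j
    using strict[of j] by (cases "q $ j = ?p $ j") (auto simp: choice_weight_def)
  show "excess \<alpha> \<gamma> s \<mu> q \<le> excess \<alpha> \<gamma> s \<mu> ?p"
    unfolding excess_def by (intro diff_right_mono sum_mono le)
  assume "q \<noteq> ?p"
  then obtain i where "q $ i \<noteq> ?p $ i" by (auto simp: vec_eq_iff)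
  then have "sum (?m q) UNIV < sum (?m ?p) UNIV"
    by (intro sum_strict_mono_ex1) (auto intro: le strict)
  then show "excess \<alpha> \<gamma> s \<mu> q < excess \<alpha> \<gamma> s \<mu> ?p"
    unfolding excess_def by simp
qed

lemma excess_strict_antimono:
  assumes "\<mu> < \<nu>"
  shows "excess \<alpha> \<gamma> s \<nu> p < excess \<alpha> \<gamma> s \<mu> p"
proof -
  have "(\<Sum>j\<in>UNIV. (p $ j - \<nu>) * choice_weight \<alpha> \<gamma> p s j)
      \<le> (\<Sum>j\<in>UNIV. (p $ j - \<mu>) * choice_weight \<alpha> \<gamma> p s j)"
    using assms by (intro sum_mono mult_right_mono less_imp_le[OF choice_weight_pos]) auto
  then show ?thesis using assms by (simp add: excess_def)
qed

section \<open>Dependence of the revenue on the index\<close>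

lemma pmax_ge: "pu $ j \<le> pmax pu"
  unfolding pmax_def by (intro Max_ge) auto

text \<open>With \<open>y\<close> the total choice weight at the current index, the derivative of the revenue with
  respect to the index is at most \<open>M y / (1 + y)\<^sup>2\<close>. This is \<open>M\<close> times the product of the purchase
  and no-purchase probabilities, hence at most \<open>M/4\<close>.\<close>

lemma revenue_index_increment:
  assumes p: "\<And>j. 0 \<le> p $ j" "\<And>j. p $ j \<le> M" and st: "s \<le> t"
  shows "revenue \<alpha> \<gamma> p s \<le> revenue \<alpha> \<gamma> p t"
    and "revenue \<alpha> \<gamma> p t - revenue \<alpha> \<gamma> p s \<le> M / 4 * (t - s)"
proof -
  define V where "V = (\<Sum>j\<in>UNIV. choice_weight \<alpha> \<gamma> p 0 j)"
  define B where "B = (\<Sum>j\<in>UNIV. p $ j * choice_weight \<alpha> \<gamma> p 0 j)"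
  have w: "choice_weight \<alpha> \<gamma> p x j = exp x * choice_weight \<alpha> \<gamma> p 0 j" for x j
    by (simp add: choice_weight_def attraction_def exp_add)
  have rev: "revenue \<alpha> \<gamma> p x = B * exp x / (1 + V * exp x)" for x
    unfolding revenue_eq w[of x] V_def B_def
    by (simp add: sum_distrib_right sum_distrib_left mult_ac)
  have V0: "V \<ge> 0" unfolding V_def by (intro sum_nonneg less_imp_le[OF choice_weight_pos])
  have B0: "B \<ge> 0" unfolding B_def
    by (intro sum_nonneg mult_nonneg_nonneg p less_imp_le[OF choice_weight_pos])
  have BV: "B \<le> M * V" unfolding B_def V_def sum_distrib_left
    by (intro sum_mono mult_right_mono p less_imp_le[OF choice_weight_pos])
  have M0: "M \<ge> 0" using p order_trans by blast
  have D: "1 + V * exp x > 0" for x using V0 by (intro add_pos_nonneg) auto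
  define d where "d x = B * exp x / (1 + V * exp x)\<^sup>2" for x
  have deriv: "((\<lambda>x. revenue \<alpha> \<gamma> p x) has_real_derivative d x) (at x)" for x
    unfolding rev d_def using D[of x]
    by (auto intro!: derivative_eq_intros simp: power2_eq_square field_simps)
  have d0: "d x \<ge> 0" for x unfolding d_def using B0 by simp
  have d_le: "d x \<le> M / 4" for x
  proof -
    define y where "y = V * exp x"
    have "B * exp x \<le> M * V * exp x" using BV by (intro mult_right_mono) auto
    also have "\<dots> = M * y" by (simp add: y_def)
    also have "\<dots> \<le> M * ((1 + y)\<^sup>2 / 4)"
    proof (intro mult_left_mono M0)
      have "(1 + y)\<^sup>2 - 4 * y = (1 - y)\<^sup>2" by (simp add: power2_eq_square algebra_simps)
      then have "(1 + y)\<^sup>2 - 4 * y \<ge> 0" by simp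
      then show "y \<le> (1 + y)\<^sup>2 / 4" by simp
    qed
    finally show ?thesis using D[of x] by (simp add: d_def y_def pos_divide_le_eq mult_ac)
  qed
  have "\<exists>z. revenue \<alpha> \<gamma> p t - revenue \<alpha> \<gamma> p s = (t - s) * d z"
  proof (cases "s = t")
    case False
    then show ?thesis using MVT2[of s t "revenue \<alpha> \<gamma> p" d] deriv st by auto
  qed simp
  then obtain z where z: "revenue \<alpha> \<gamma> p t - revenue \<alpha> \<gamma> p s = (t - s) * d z" ..
  have "(t - s) * d z \<ge> 0" using st d0 by simp
  then show "revenue \<alpha> \<gamma> p s \<le> revenue \<alpha> \<gamma> p t" using z by simp
  have "(t - s) * d z \<le> (t - s) * (M / 4)" using st d_le by (intro mult_left_mono) auto
  then show "revenue \<alpha> \<gamma> p t - revenue \<alpha> \<gamma> p s \<le> M / 4 * (t - s)"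
    using z by (simp add: mult.commute)
qed

section \<open>Bisection\<close>

lemma bisect_brackets:
  assumes "a \<le> r" "r \<le> b"
    and "\<And>x. f x \<ge> 0 \<Longrightarrow> x \<le> r" "\<And>x. f x < 0 \<Longrightarrow> r \<le> x"
  shows "case bisect f a b n of (l, u) \<Rightarrow> l \<le> r \<and> r \<le> u \<and> u - l = (b - a) / 2 ^ n"
proof (induction n)
  case 0
  then show ?case using assms by simp
next
  case (Suc n)
  obtain l u where lu: "bisect f a b n = (l, u)" by fastforce
  define m where "m = (l + u) / 2"
  have IH: "l \<le> r" "r \<le> u" "u - l = (b - a) / 2 ^ n" using Suc by (simp_all add: lu)
  have "u - m = (u - l) / 2" "m - l = (u - l) / 2" by (simp_all add: m_def field_simps)
  then have half: "u - m = (b - a) / 2 ^ Suc n" "m - l = (b - a) / 2 ^ Suc n"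
    by (simp_all only: IH(3)) simp_all
  show ?case
  proof (cases "f m \<ge> 0")
    case True
    then have "bisect f a b (Suc n) = (m, u)" by (simp add: lu m_def)
    then show ?thesis using assms(3)[OF True] IH half by (simp only: prod.case)
  next
    case False
    then have "bisect f a b (Suc n) = (l, m)" by (simp add: lu m_def)
    then show ?thesis using assms(4)[of m] False IH half by (simp only: prod.case not_le)
  qed
qed

lemma bisect_midpoint_tendsto:
  assumes "\<And>n. case bisect f a b n of (l, u) \<Rightarrow> l \<le> r \<and> r \<le> u \<and> u - l = (b - a) / 2 ^ n"
  shows "(\<lambda>n. case bisect f a b n of (l, u) \<Rightarrow> (l + u) / 2) \<longlonglongrightarrow> r"
proof -
  have "(\<lambda>n. (b - a) * (1 / 2) ^ n) \<longlonglongrightarrow> (b - a) * 0"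
    by (intro tendsto_mult_left LIMSEQ_power_zero) simp
  then have null: "(\<lambda>n. (b - a) / 2 ^ n) \<longlonglongrightarrow> 0" by (simp add: power_divide)
  have "\<bar>(case bisect f a b n of (l, u) \<Rightarrow> (l + u) / 2) - r\<bar> \<le> (b - a) / 2 ^ n" for n
  proof -
    obtain l u where lu: "bisect f a b n = (l, u)" by fastforce
    then have r: "l \<le> r" "r \<le> u" and width: "u - l = (b - a) / 2 ^ n"
      using assms[of n] by simp_all
    have "\<bar>(l + u) / 2 - r\<bar> \<le> u - l" using r by (simp add: abs_le_iff field_simps)
    then show ?thesis unfolding lu prod.case width .
  qed
  then have "(\<lambda>n. (case bisect f a b n of (l, u) \<Rightarrow> (l + u) / 2) - r) \<longlonglongrightarrow> 0"
    by (intro Lim_null_comparison[OF _ null]) (auto simp: eventually_sequentially)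
  then show ?thesis by (simp add: LIM_zero_iff)
qed

section \<open>The optimal prices of a leaf\<close>

locale leaf_pricing =
  fixes \<alpha> \<gamma> pl pu :: "real ^ 'j::finite"
  assumes sensitivity_pos: "\<gamma> $ j > 0"
    and lower_nonneg: "0 \<le> pl $ j"
    and lower_less_upper: "pl $ j < pu $ j"
begin

abbreviation "price \<equiv> price_at \<gamma> pl pu"
abbreviation "\<Phi> \<equiv> Phi \<alpha> \<gamma> pl pu"
abbreviation "\<mu>\<^sub>s \<equiv> mu_star \<alpha> \<gamma> pl pu"

lemma price_bounds: "pl $ j \<le> price \<mu> $ j" "price \<mu> $ j \<le> pu $ j"
  using clip_mem[of "pl $ j" "pu $ j"] lower_less_upper[of j]
  by (auto simp: price_at_def less_imp_le)

lemma price_in_box: "price \<mu> \<in> cbox pl pu"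
  using price_bounds by (simp add: mem_box_cart)

lemma price_nonneg: "0 \<le> price \<mu> $ j"
  using price_bounds(1)[of j \<mu>] lower_nonneg[of j] by simp

lemma price_le_pmax: "price \<mu> $ j \<le> pmax pu"
  using price_bounds(2)[of \<mu> j] pmax_ge[of pu j] by simp

lemma pmax_nonneg: "0 \<le> pmax pu"
  using price_nonneg price_le_pmax order_trans by blast

lemma Phi_sgn: "sgn (\<Phi> s \<mu>) = sgn (excess \<alpha> \<gamma> s \<mu> (price \<mu>))"
  using choice_denominator_pos[of \<alpha> \<gamma> "price \<mu>" s]
  by (simp add: Phi_eq revenue_minus_eq_excess sgn_divide)

text \<open>The maximal excess decreases in the target, since the excess of every single price vector
  does.\<close>

lemma max_excess_strict_antimono:
  assumes "\<mu> < \<nu>"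
  shows "excess \<alpha> \<gamma> s \<nu> (price \<nu>) < excess \<alpha> \<gamma> s \<mu> (price \<mu>)"
  using excess_strict_antimono[OF assms, of \<alpha> \<gamma> s "price \<nu>"]
    excess_le(1)[OF sensitivity_pos price_in_box, of \<alpha> s \<mu> \<nu>] by linarith

lemma Phi_sign_change:
  assumes "\<Phi> s r = 0"
  shows "\<mu> < r \<Longrightarrow> \<Phi> s \<mu> > 0" "r < \<mu> \<Longrightarrow> \<Phi> s \<mu> < 0"
proof -
  have "excess \<alpha> \<gamma> s r (price r) = 0"
    using Phi_sgn[of s r] assms by (simp add: sgn_0_0)
  then show "\<mu> < r \<Longrightarrow> \<Phi> s \<mu> > 0" "r < \<mu> \<Longrightarrow> \<Phi> s \<mu> < 0"
    using max_excess_strict_antimono[of \<mu> r s] max_excess_strict_antimono[of r \<mu> s]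
      Phi_sgn[of s \<mu>] by (simp_all add: sgn_if split: if_splits)
qed

lemma Phi_continuous: "continuous_on S (\<Phi> s)"
proof -
  have "1 + (\<Sum>r\<in>UNIV. attraction \<alpha> s r * exp (- \<gamma> $ r * price \<mu> $ r)) \<noteq> 0" for \<mu>
    using choice_denominator_pos[of \<alpha> \<gamma> "price \<mu>" s] by (simp add: choice_weight_def)
  then show ?thesis
    unfolding Phi_def choice_prob_def by (intro continuous_intros continuous_on_price_at) auto
qed

lemma Phi_ends: "\<Phi> s 0 \<ge> 0" "\<Phi> s (pmax pu) \<le> 0"
proof -
  have "excess \<alpha> \<gamma> s 0 (price 0) \<ge> 0"
    unfolding excess_def
    by (simp add: sum_nonneg price_nonneg less_imp_le[OF choice_weight_pos])
  then show "\<Phi> s 0 \<ge> 0"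
    using Phi_sgn[of s 0] by (simp add: sgn_if split: if_splits)
  have "(\<Sum>j\<in>UNIV. (price (pmax pu) $ j - pmax pu) * choice_weight \<alpha> \<gamma> (price (pmax pu)) s j) \<le> 0"
    by (intro sum_nonpos mult_nonpos_nonneg less_imp_le[OF choice_weight_pos])
      (simp add: price_le_pmax)
  then have "excess \<alpha> \<gamma> s (pmax pu) (price (pmax pu)) \<le> 0"
    using pmax_nonneg by (simp add: excess_def)
  then show "\<Phi> s (pmax pu) \<le> 0"
    using Phi_sgn[of s "pmax pu"] by (simp add: sgn_if split: if_splits)
qed

lemma Phi_root_ex1: "\<exists>!\<mu>. \<mu> \<in> {0..pmax pu} \<and> \<Phi> s \<mu> = 0"
proof -
  have "\<exists>\<mu>. 0 \<le> \<mu> \<and> \<mu> \<le> pmax pu \<and> \<Phi> s \<mu> = 0"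
    by (intro IVT2' Phi_ends pmax_nonneg Phi_continuous)
  moreover have "\<mu> = \<nu>" if "\<Phi> s \<mu> = 0" "\<Phi> s \<nu> = 0" for \<mu> \<nu>
    using Phi_sign_change[OF that(1), of \<nu>] that(2) by (cases \<mu> \<nu> rule: linorder_cases) auto
  ultimately show ?thesis by auto
qed

lemma mu_star_root: "\<mu>\<^sub>s s \<in> {0..pmax pu}" "\<Phi> s (\<mu>\<^sub>s s) = 0"
  using theI'[OF Phi_root_ex1[of s]] by (simp_all add: mu_star_def)

lemma revenue_price_mu_star: "revenue \<alpha> \<gamma> (price (\<mu>\<^sub>s s)) s = \<mu>\<^sub>s s"
  using mu_star_root(2)[of s] by (simp add: Phi_eq)

text \<open>At the root the maximal excess is zero, so every other price vector in the box has negative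
  excess, that is, revenue below \<open>\<mu>\<^sup>*\<close>.\<close>

lemma revenue_less_mu_star:
  assumes "q \<in> cbox pl pu" "q \<noteq> price (\<mu>\<^sub>s s)"
  shows "revenue \<alpha> \<gamma> q s < \<mu>\<^sub>s s"
proof -
  have "excess \<alpha> \<gamma> s (\<mu>\<^sub>s s) (price (\<mu>\<^sub>s s)) = 0"
    using Phi_sgn[of s "\<mu>\<^sub>s s"] mu_star_root(2)[of s] by (simp add: sgn_0_0)
  then have "excess \<alpha> \<gamma> s (\<mu>\<^sub>s s) q < 0"
    using excess_le(2)[OF sensitivity_pos assms, of \<alpha> s] by simp
  then have "revenue \<alpha> \<gamma> q s - \<mu>\<^sub>s s < 0"
    using choice_denominator_pos[of \<alpha> \<gamma> q s]
    by (simp add: revenue_minus_eq_excess divide_neg_pos)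
  then show ?thesis by simp
qed

lemma revenue_le_mu_star: "q \<in> cbox pl pu \<Longrightarrow> revenue \<alpha> \<gamma> q s \<le> \<mu>\<^sub>s s"
  using revenue_less_mu_star[of q s] revenue_price_mu_star[of s]
  by (cases "q = price (\<mu>\<^sub>s s)") auto

lemma is_opt_price_iff: "is_opt_price \<alpha> \<gamma> pl pu s p \<longleftrightarrow> p = price (\<mu>\<^sub>s s)"
proof
  assume p: "is_opt_price \<alpha> \<gamma> pl pu s p"
  then have "p \<in> cbox pl pu" "\<not> revenue \<alpha> \<gamma> p s < revenue \<alpha> \<gamma> (price (\<mu>\<^sub>s s)) s"
    using price_in_box[of "\<mu>\<^sub>s s"] by (auto simp: is_opt_price_def is_arg_max_def)
  then show "p = price (\<mu>\<^sub>s s)"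
    using revenue_less_mu_star[of p s] by (auto simp: revenue_price_mu_star)
next
  assume "p = price (\<mu>\<^sub>s s)"
  then show "is_opt_price \<alpha> \<gamma> pl pu s p"
    using revenue_le_mu_star[of _ s] price_in_box
    by (auto simp: is_opt_price_def is_arg_max_def revenue_price_mu_star not_less)
qed

lemma opt_price_eq: "opt_price \<alpha> \<gamma> pl pu s = price (\<mu>\<^sub>s s)"
  by (simp add: opt_price_def is_opt_price_iff)

text \<open>The prices optimal at \<open>s\<close> earn at least as much at \<open>t\<close>, and those optimal at \<open>t\<close> lose
  at most \<open>(p\<^sub>m\<^sub>a\<^sub>x/4) (t - s)\<close> when the index falls back to \<open>s\<close>.\<close>

lemma mu_star_increment:
  assumes "s \<le> t"
  shows "\<mu>\<^sub>s s \<le> \<mu>\<^sub>s t" and "\<mu>\<^sub>s t - \<mu>\<^sub>s s \<le> pmax pu / 4 * (t - s)"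
proof -
  show "\<mu>\<^sub>s s \<le> \<mu>\<^sub>s t"
    using revenue_index_increment(1)[OF price_nonneg price_le_pmax assms, of \<alpha> \<gamma> "\<mu>\<^sub>s s"]
      revenue_le_mu_star[OF price_in_box, of "\<mu>\<^sub>s s" t]
    by (simp add: revenue_price_mu_star)
  show "\<mu>\<^sub>s t - \<mu>\<^sub>s s \<le> pmax pu / 4 * (t - s)"
    using revenue_index_increment(2)[OF price_nonneg price_le_pmax assms, of \<alpha> \<gamma> "\<mu>\<^sub>s t"]
      revenue_le_mu_star[OF price_in_box, of "\<mu>\<^sub>s t" s]
    by (simp add: revenue_price_mu_star)
qed

lemma mu_star_lipschitz: "\<bar>\<mu>\<^sub>s s - \<mu>\<^sub>s t\<bar> \<le> pmax pu / 4 * \<bar>s - t\<bar>"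
  using mu_star_increment[of s t] mu_star_increment[of t s]
  by (cases "s \<le> t") (simp_all add: abs_if)

lemma opt_price_mono: "mono (\<lambda>s. opt_price \<alpha> \<gamma> pl pu s $ j)"
  by (intro monoI) (simp add: opt_price_eq price_at_mono mu_star_increment(1))

lemma opt_price_lipschitz:
  "infnorm (opt_price \<alpha> \<gamma> pl pu s - opt_price \<alpha> \<gamma> pl pu t) \<le> pmax pu / 4 * \<bar>s - t\<bar>"
  using infnorm_price_at_diff_le mu_star_lipschitz unfolding opt_price_eq by (rule order_trans)

lemma bisect_Phi_brackets:
  "case bisect (\<Phi> s) 0 (pmax pu) n of (l, u) \<Rightarrow>
     l \<le> \<mu>\<^sub>s s \<and> \<mu>\<^sub>s s \<le> u \<and> u - l = (pmax pu - 0) / 2 ^ n"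
proof (rule bisect_brackets)
  show "0 \<le> \<mu>\<^sub>s s" "\<mu>\<^sub>s s \<le> pmax pu" using mu_star_root(1)[of s] by auto
  show "x \<le> \<mu>\<^sub>s s" if "\<Phi> s x \<ge> 0" for x
    using Phi_sign_change(2)[OF mu_star_root(2), of s x] that by linarith
  show "\<mu>\<^sub>s s \<le> x" if "\<Phi> s x < 0" for x
    using Phi_sign_change(1)[OF mu_star_root(2), of x s] that by linarith
qed

lemma bisect_price_tendsto:
  "(\<lambda>n. case bisect (\<Phi> s) 0 (pmax pu) n of (l, u) \<Rightarrow> price ((l + u) / 2))
     \<longlonglongrightarrow> opt_price \<alpha> \<gamma> pl pu s"
proof -
  have "(\<lambda>n. price (case bisect (\<Phi> s) 0 (pmax pu) n of (l, u) \<Rightarrow> (l + u) / 2))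
      \<longlonglongrightarrow> price (\<mu>\<^sub>s s)"
    using continuous_on_price_at[of UNIV \<gamma> pl pu]
    by (intro continuous_on_tendsto_compose[OF _ bisect_midpoint_tendsto[OF bisect_Phi_brackets]])
      auto
  then show ?thesis by (simp add: opt_price_eq prod.case_distrib)
qed

end

section \<open>Customers enter through their index\<close>

lemma mnl_eq_choice_prob: "mnl (utility \<alpha> \<beta> \<gamma> x p) j = choice_prob \<alpha> \<gamma> p (\<beta> \<bullet> x) j"
  by (simp add: mnl_def utility_def choice_prob_def attraction_def flip: exp_add)

lemma is_customer_opt_price_iff:
  "is_customer_opt_price \<alpha> \<beta> \<gamma> pl pu x p \<longleftrightarrow> is_opt_price \<alpha> \<gamma> pl pu (\<beta> \<bullet> x) p"
  by (simp add: is_customer_opt_price_def is_opt_price_def customer_revenue_def[abs_def]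
      revenue_def mnl_eq_choice_prob)

lemma customer_opt_price_eq:
  "customer_opt_price \<alpha> \<beta> \<gamma> pl pu x = opt_price \<alpha> \<gamma> pl pu (\<beta> \<bullet> x)"
  by (simp add: customer_opt_price_def opt_price_def is_customer_opt_price_iff)

section \<open>An evaluation procedure of linear cost\<close>

definition sum_expr :: "('a \<Rightarrow> 'j aexp) \<Rightarrow> real \<Rightarrow> 'a list \<Rightarrow> 'j aexp" where
  "sum_expr f c xs = foldr (\<lambda>i. Add (f i)) xs (Const c)"

lemma aeval_sum_expr: "aeval \<rho> (sum_expr f c xs) = (\<Sum>i\<leftarrow>xs. aeval \<rho> (f i)) + c"
  by (induction xs) (simp_all add: sum_expr_def)

lemma cost_sum_expr: "cost (sum_expr f c xs) = (\<Sum>i\<leftarrow>xs. 1 + cost (f i)) + 1"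
  by (induction xs) (simp_all add: sum_expr_def)

definition price_expr :: "'j \<Rightarrow> 'j aexp" where
  "price_expr j = Minimum (Maximum (Add (Div (Const 1) (Input (In_gamma j))) (Input In_mu))
     (Input (In_lower j))) (Input (In_upper j))"

definition weight_expr :: "'j \<Rightarrow> 'j aexp" where
  "weight_expr j = Expo (Sub (Add (Input (In_alpha j)) (Input In_s))
     (Mul (Input (In_gamma j)) (price_expr j)))"

text \<open>The denominator is shared: \<open>\<Phi>\<close> is evaluated as one quotient of two sums, not as a sum of
  quotients, which would have quadratic cost.\<close>

definition Phi_expr :: "'j list \<Rightarrow> 'j aexp" where
  "Phi_expr js = Sub
     (Div (sum_expr (\<lambda>j. Mul (price_expr j) (weight_expr j)) 0 js) (sum_expr weight_expr 1 js))
     (Input In_mu)"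

lemma aeval_price_expr:
  "aeval (problem_data \<alpha> \<gamma> pl pu s \<mu>) (price_expr j) = price_at \<gamma> pl pu \<mu> $ j"
  by (simp add: price_expr_def price_at_def clip_def inverse_eq_divide)

lemma aeval_weight_expr:
  "aeval (problem_data \<alpha> \<gamma> pl pu s \<mu>) (weight_expr j) =
     choice_weight \<alpha> \<gamma> (price_at \<gamma> pl pu \<mu>) s j"
  by (simp add: weight_expr_def aeval_price_expr choice_weight_def attraction_def flip: exp_add)

lemma evaluates_Phi_expr:
  assumes "distinct js" "set js = (UNIV :: 'j::finite set)"
  shows "evaluates_Phi (Phi_expr js)"
  by (simp add: evaluates_Phi_def Phi_expr_def aeval_sum_expr aeval_price_expr aeval_weight_expr
      Phi_eq revenue_eq sum_list_distinct_conv_sum_set assms add.commute)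

lemma cost_Phi_expr: "cost (Phi_expr js) = 44 * length js + 5"
  by (simp add: Phi_expr_def cost_sum_expr price_expr_def weight_expr_def sum_list_triv)

lemma ex_linear_cost_evaluation:
  "\<exists>e :: 'j::finite aexp. evaluates_Phi e \<and> cost e \<le> 50 * CARD('j)"
proof -
  obtain js where js: "set js = (UNIV :: 'j set)" "distinct js"
    using finite_distinct_list[OF finite] by blast
  then have "length js = CARD('j)" using distinct_card by fastforce
  moreover have "CARD('j) \<ge> 1" by (simp add: Suc_leI)
  ultimately have "cost (Phi_expr js) \<le> 50 * CARD('j)" unfolding cost_Phi_expr by linarith
  then show ?thesis using evaluates_Phi_expr[OF js(2,1)] by blast
qed

section \<open>Characterization and regularity of the optimal price map\<close>

theorem proposition4:
  fixes route :: "real ^ 'd::finite \<Rightarrow> 'k"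
    and \<alpha> \<gamma> :: "'k \<Rightarrow> real ^ 'j::finite"
    and \<beta> :: "'k \<Rightarrow> real ^ 'd"
    and k :: 'k
    and pl pu :: "real ^ 'j"
    and \<gamma>_lb :: real
  assumes "\<gamma>_lb > 0"
    and "\<And>j. \<gamma> k $ j \<ge> \<gamma>_lb"
    and "\<And>j. 0 \<le> pl $ j"
    and "\<And>j. pl $ j < pu $ j"
  shows
    "(\<forall>s. \<exists>!p. is_opt_price (\<alpha> k) (\<gamma> k) pl pu s p)
     \<and>
     (\<forall>s. (\<exists>!\<mu>. \<mu> \<in> {0..pmax pu} \<and> Phi (\<alpha> k) (\<gamma> k) pl pu s \<mu> = 0)
        \<and> opt_price (\<alpha> k) (\<gamma> k) pl pu s = price_at (\<gamma> k) pl pu (mu_star (\<alpha> k) (\<gamma> k) pl pu s)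
        \<and> (\<forall>n. case bisect (Phi (\<alpha> k) (\<gamma> k) pl pu s) 0 (pmax pu) n of (l, u) \<Rightarrow>
              l \<le> mu_star (\<alpha> k) (\<gamma> k) pl pu s \<and> mu_star (\<alpha> k) (\<gamma> k) pl pu s \<le> u
              \<and> u - l = pmax pu / 2 ^ n)
        \<and> (\<lambda>n. case bisect (Phi (\<alpha> k) (\<gamma> k) pl pu s) 0 (pmax pu) n of (l, u) \<Rightarrow>
              price_at (\<gamma> k) pl pu ((l + u) / 2)) \<longlonglongrightarrow> opt_price (\<alpha> k) (\<gamma> k) pl pu s)
     \<and>
     (\<exists>e :: 'j aexp. evaluates_Phi e \<and> cost e \<le> 50 * CARD('j))
     \<and>
     (\<forall>x y. route x = k \<and> route y = k \<and> \<beta> k \<bullet> x = \<beta> k \<bullet> y \<longrightarrow>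
        customer_opt_price (\<alpha> (route x)) (\<beta> (route x)) (\<gamma> (route x)) pl pu x =
        customer_opt_price (\<alpha> (route y)) (\<beta> (route y)) (\<gamma> (route y)) pl pu y)
     \<and>
     (\<forall>x. route x = k \<longrightarrow>
        (\<exists>!p. is_customer_opt_price (\<alpha> (route x)) (\<beta> (route x)) (\<gamma> (route x)) pl pu x p)
        \<and> customer_opt_price (\<alpha> (route x)) (\<beta> (route x)) (\<gamma> (route x)) pl pu x =
          opt_price (\<alpha> k) (\<gamma> k) pl pu (\<beta> k \<bullet> x))
     \<and>
     (\<forall>j. mono (\<lambda>s. opt_price (\<alpha> k) (\<gamma> k) pl pu s $ j))
     \<and>
     (\<forall>s s'. infnorm (opt_price (\<alpha> k) (\<gamma> k) pl pu s - opt_price (\<alpha> k) (\<gamma> k) pl pu s')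
        \<le> pmax pu / 4 * \<bar>s - s'\<bar>)"
proof -
  interpret leaf_pricing "\<alpha> k" "\<gamma> k" pl pu
  proof
    show "\<gamma> k $ j > 0" for j using assms(1) assms(2)[of j] by linarith
  qed (use assms in auto)
  show ?thesis
  proof (intro conjI allI impI)
    show "\<exists>!p. is_opt_price (\<alpha> k) (\<gamma> k) pl pu s p" for s
      by (simp add: is_opt_price_iff)
    show "case bisect (\<Phi> s) 0 (pmax pu) n of (l, u) \<Rightarrow>
        l \<le> \<mu>\<^sub>s s \<and> \<mu>\<^sub>s s \<le> u \<and> u - l = pmax pu / 2 ^ n" for s n
      using bisect_Phi_brackets[of s n] by simp
    show "\<exists>!p. is_customer_opt_price (\<alpha> (route x)) (\<beta> (route x)) (\<gamma> (route x)) pl pu x p"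
      if "route x = k" for x
      using that by (simp add: is_customer_opt_price_iff is_opt_price_iff)
    show "\<exists>!\<mu>. \<mu> \<in> {0..pmax pu} \<and> \<Phi> s \<mu> = 0" for s
      by (rule Phi_root_ex1)
    show "infnorm (opt_price (\<alpha> k) (\<gamma> k) pl pu s - opt_price (\<alpha> k) (\<gamma> k) pl pu s')
        \<le> pmax pu / 4 * \<bar>s - s'\<bar>" for s s'
      by (rule opt_price_lipschitz)
  qed (simp_all add: customer_opt_price_eq opt_price_eq[symmetric] bisect_price_tendsto
      ex_linear_cost_evaluation opt_price_mono)
qed

end
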